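(* For every prime power $q$, the number $I_{\mathrm{H}}(q)$ of $\mathbb{F}_q$-isomorphism classes of Hessian curves over $\mathbb{F}_q$ is $\lfloor (q+11)/12\rfloor$ if $q\equiv1\pmod3$, and $q-1$ if $q\equiv0,2\pmod3$.
   Context: For $u\in\mathbb{F}_q$ with $u^3\ne27$, the Hessian curve $E_{\mathrm{H},u}$ is the elliptic curve $X^3+Y^3+1=uXY$. Two such curves are $\mathbb{F}_q$-isomorphic if they are birationally equivalent over $\mathbb{F}_q$ (equivalently, their Weierstrass models are isomorphic via a Weierstrass change of variables with coefficients in $\mathbb{F}_q$). $I_{\mathrm{H}}(q)$ is the number of equivalence classes of $\{E_{\mathrm{H},u}: u\in\mathbb{F}_q,\ u^3\ne27\}$ under $\mathbb{F}_q$-isomorphism. *)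

theory Defs
  imports Main "HOL-Library.Cardinality"
begin

text \<open>Generalized Weierstrass equations
  y^2 + a1 x y + a3 y = x^3 + a2 x^2 + a4 x + a6,
  represented by their coefficient tuple (a1, a2, a3, a4, a6).\<close>

type_synonym 'a weierstrass = "'a \<times> 'a \<times> 'a \<times> 'a \<times> 'a"

text \<open>Isomorphism of Weierstrass equations over the field: existence of an
  admissible change of variables x = v^2 x' + r, y = v^3 y' + s v^2 x' + t
  with v nonzero and v, r, s, t in the field (Silverman, Table 3.1).\<close>

definition weier_iso :: "'a::field weierstrass \<Rightarrow> 'a weierstrass \<Rightarrow> bool" where
  "weier_iso E E' \<longleftrightarrow>
     (case E of (a1, a2, a3, a4, a6) \<Rightarrow> case E' of (b1, b2, b3, b4, b6) \<Rightarrow>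
       (\<exists>v r s t. v \<noteq> 0 \<and>
          v * b1 = a1 + 2 * s \<and>
          v ^ 2 * b2 = a2 - s * a1 + 3 * r - s ^ 2 \<and>
          v ^ 3 * b3 = a3 + r * a1 + 2 * t \<and>
          v ^ 4 * b4 = a4 - s * a3 + 2 * r * a2 - (t + r * s) * a1 + 3 * r ^ 2 - 2 * s * t \<and>
          v ^ 6 * b6 = a6 + r * a4 + r ^ 2 * a2 + r ^ 3 - t * a3 - t ^ 2 - r * t * a1))"

text \<open>Weierstrass model of the Hessian curve X^3 + Y^3 + 1 = u X Y (with base
  point (1:-1:0)):  y^2 + (u+6) x y + (u^2+3u+9) y = x^3.  It is obtained by the
  projective change of coordinates
  x = -(u^2+3u+9)(X+Y+Z), y = (u^2+3u+9)(uX+3Y+3Z), z = 3X+3Y+uZ,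
  via the integer polynomial identity
  (u-3)^2 (X^3+Y^3+Z^3-uXYZ) = B^2 C - (u+6) A B C + B C^2 + (u^2+3u+9) A^3
  with A = X+Y+Z, B = uX+3Y+3Z, C = 3X+3Y+uZ; the change is invertible
  exactly when u^3 \<noteq> 27 (determinant -(u-3)^2 times unit factors).\<close>

definition hessian_weier :: "'a::field \<Rightarrow> 'a weierstrass" where
  "hessian_weier u = (u + 6, 0, u ^ 2 + 3 * u + 9, 0, 0)"

definition hessian_params :: "'a::field set" where
  "hessian_params = {u. u ^ 3 \<noteq> 27}"

definition hessian_iso_rel :: "'a::field rel" where
  "hessian_iso_rel = {(u, w). u \<in> hessian_params \<and> w \<in> hessian_params \<and>
                              weier_iso (hessian_weier u) (hessian_weier w)}"

definition I_H :: "'a::{finite, field} itself \<Rightarrow> nat" where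
  "I_H _ = card (hessian_params // (hessian_iso_rel :: 'a rel))"

end

(*
  The cases are separated by whether cubing is injective on the field.  If it is, a curve
  has no affine flex besides (0, 0) and its negative, so an isomorphism only rescales, and the
  ratio (u + 6)^3 / (u - 3)^3 (in characteristic 3: u itself) recovers u; all q - 1 curves are
  pairwise non-isomorphic.  Otherwise 3 is invertible and there is a primitive cube root of
  unity \<omega>.  All nine flexes are then rational, and the maps u -> \<omega> u and u -> 3 (u + 6) / (u - 3),
  generating a group of order 12, are realized by isomorphisms; their orbits are the fibers of the
  j-invariant.  A fiber has 12 elements, except over j = 0 (4, or 1 in characteristic 2) and over
  j = 1728 in odd characteristic (6 or 0), and the fibers partition the q - 3 admissible
  parameters.
*)

theory Submission
  imports Defs "HOL-Computational_Algebra.Polynomial"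
begin

section \<open>Composition of Weierstrass changes of variables\<close>

lemma weier_iso_trans:
  assumes "weier_iso E F" and "weier_iso F G"
  shows "weier_iso E G"
proof -
  obtain a1 a2 a3 a4 a6 where E: "E = (a1, a2, a3, a4, a6)" by (metis surj_pair)
  obtain b1 b2 b3 b4 b6 where F: "F = (b1, b2, b3, b4, b6)" by (metis surj_pair)
  obtain c1 c2 c3 c4 c6 where G: "G = (c1, c2, c3, c4, c6)" by (metis surj_pair)
  obtain v r s t where v: "v \<noteq> 0" and 1:
    "v * b1 = a1 + 2 * s"
    "v ^ 2 * b2 = a2 - s * a1 + 3 * r - s ^ 2"
    "v ^ 3 * b3 = a3 + r * a1 + 2 * t"
    "v ^ 4 * b4 = a4 - s * a3 + 2 * r * a2 - (t + r * s) * a1 + 3 * r ^ 2 - 2 * s * t"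
    "v ^ 6 * b6 = a6 + r * a4 + r ^ 2 * a2 + r ^ 3 - t * a3 - t ^ 2 - r * t * a1"
    using assms(1) unfolding E F weier_iso_def by auto
  obtain v' r' s' t' where v': "v' \<noteq> 0" and 2:
    "v' * c1 = b1 + 2 * s'"
    "v' ^ 2 * c2 = b2 - s' * b1 + 3 * r' - s' ^ 2"
    "v' ^ 3 * c3 = b3 + r' * b1 + 2 * t'"
    "v' ^ 4 * c4 = b4 - s' * b3 + 2 * r' * b2 - (t' + r' * s') * b1 + 3 * r' ^ 2 - 2 * s' * t'"
    "v' ^ 6 * c6 = b6 + r' * b4 + r' ^ 2 * b2 + r' ^ 3 - t' * b3 - t' ^ 2 - r' * t' * b1"
    using assms(2) unfolding F G weier_iso_def by auto
  \<comment> \<open>Coefficients of the composite substitution, obtained by inserting the second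
    change of variables into the first; its scaling factor is \<open>v * v'\<close>.\<close>
  define R S T where "R = v^2 * r' + r" and "S = s + v * s'" and "T = t + v^3 * t' + v^2 * s * r'"
  have "(v * v') * c1 = a1 + 2 * S"
    unfolding S_def using 1 2 by algebra
  moreover have "(v * v') ^ 2 * c2 = a2 - S * a1 + 3 * R - S ^ 2"
    unfolding S_def R_def using 1(1,2) 2(2) by algebra
  moreover have "(v * v') ^ 3 * c3 = a3 + R * a1 + 2 * T"
    unfolding R_def T_def using 1(1,3) 2(3) by algebra
  moreover have "(v * v') ^ 4 * c4
      = a4 - S * a3 + 2 * R * a2 - (T + R * S) * a1 + 3 * R ^ 2 - 2 * S * T"
    unfolding R_def S_def T_def using 1(1-4) 2(4) by algebra
  moreover have "(v * v') ^ 6 * c6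
      = a6 + R * a4 + R ^ 2 * a2 + R ^ 3 - T * a3 - T ^ 2 - R * T * a1"
    unfolding R_def T_def using 1 2(5) by algebra
  moreover have "v * v' \<noteq> 0"
    using v v' by simp
  ultimately show ?thesis
    unfolding E G weier_iso_def prod.case by blast
qed

lemma weier_iso_refl: "weier_iso E E"
proof (cases E)
  case (fields a1 a2 a3 a4 a6)
  show ?thesis
    unfolding weier_iso_def fields prod.case
    by (rule exI[of _ 1], (rule exI[of _ 0])+) simp
qed

section \<open>Curves with a flex at the origin and their invariants\<close>

text \<open>The vanishing target coefficients have a geometric meaning: \<open>(r, t)\<close> lies
  on the source curve, \<open>s\<close> is the slope of a tangent there, and
  \<open>3 * r = s^2 + s * a\<close> makes the contact threefold. An isomorphism thus amounts to
  choosing a flex to move to the origin, and a scaling \<open>v\<close>.\<close>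

lemma weier_iso_flex_form_iff:
  "weier_iso (a, 0, d, 0, 0) (b, 0, e, 0, 0) \<longleftrightarrow>
    (\<exists>v r s t. v \<noteq> 0 \<and> v * b = a + 2 * s \<and> 3 * r = s^2 + s * a \<and> v^3 * e = d + r * a + 2 * t \<and>
       s * d + (t + r * s) * a + 2 * s * t = 3 * r^2 \<and> r^3 = t * (t + d + r * a))"
  unfolding weier_iso_def prod.case
  by (intro iff_exI conj_cong refl) (auto simp: algebra_simps power2_eq_square add_eq_0_iff2)

text \<open>The left-hand side is the 3-division polynomial at \<open>r\<close>: flexes are the
  points of order 3.\<close>

lemma flex_division_polynomial:
  fixes a d r s t :: "'a::field"
  assumes "3 * r = s^2 + s * a"
    and "s * d + (t + r * s) * a + 2 * s * t = 3 * r^2"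
    and "r^3 = t * (t + d + r * a)"
  shows "r * (3 * r^3 + a^2 * r^2 + 3 * a * d * r + 3 * d^2) = 0"
proof -
  \<comment> \<open>\<open>w\<close> is the intercept of the flex tangent y = s x + w. Substituting
    this line into the curve must give (x - r)^3; the next two facts compare the linear and constant
    coefficients. Squaring \<open>2 * s + a\<close> then eliminates \<open>s\<close>.\<close>
  define w where "w = t - s * r"
  have w: "w * (2 * s + a) = - 3 * r^2 - d * s"
    unfolding w_def using assms(1,2) by algebra
  have w3: "w^2 + d * w = r^3"
    unfolding w_def using assms by algebra
  have "(2 * s + a)^2 * r^3 = (w * (2 * s + a))^2 + d * (w * (2 * s + a)) * (2 * s + a)"
    unfolding w3[symmetric] by algebra
  also have "\<dots> = (3 * r^2 + d * s)^2 - d * (3 * r^2 + d * s) * (2 * s + a)"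
    unfolding w by algebra
  finally have "(2 * s + a)^2 * r^3 = (3 * r^2 + d * s)^2 - d * (3 * r^2 + d * s) * (2 * s + a)" .
  moreover have "(2 * s + a)^2 = 12 * r + a^2"
    using assms(1) by algebra
  moreover have "(3 * r^2 + d * s)^2 - d * (3 * r^2 + d * s) * (2 * s + a)
      = 9 * r^4 - 3 * a * d * r^2 - 3 * d^2 * r"
    using assms(1) by algebra
  ultimately have "(12 * r + a^2) * r^3 = 9 * r^4 - 3 * a * d * r^2 - 3 * d^2 * r"
    by simp
  then show ?thesis by algebra
qed

text \<open>These are the transformation laws of c4 and of the discriminant. They follow from those
  of the standard quantities b2, b4, b6, b8, which here are a^2, a d, d^2 and 0.\<close>

lemma flex_form_invariants:
  fixes a b d e v r s t :: "'a::field"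
  assumes 1: "v * b = a + 2 * s" and 2: "3 * r = s^2 + s * a" and 3: "v^3 * e = d + r * a + 2 * t"
    and 4: "s * d + (t + r * s) * a + 2 * s * t = 3 * r^2" and 5: "r^3 = t * (t + d + r * a)"
  shows "v^4 * (b * (b^3 - 24 * e)) = a * (a^3 - 24 * d)"
    and "v^12 * (e^3 * (b^3 - 27 * e)) = d^3 * (a^3 - 27 * d)"
proof -
  have b2: "v^2 * b^2 = a^2 + 12 * r"
    using 1 2 by algebra
  have b4: "v^4 * (b * e) = a * d + r * a^2 + 6 * r^2"
    using 1 3 4 by algebra
  have b6: "v^6 * e^2 = d^2 + 4 * r^3 + 2 * r * a * d + r^2 * a^2"
    using 3 5 by algebra
  have b8: "r * (3 * r^3 + a^2 * r^2 + 3 * a * d * r + 3 * d^2) = 0"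
    by (rule flex_division_polynomial[OF 2 4 5])
  have "v^4 * (b * (b^3 - 24 * e)) = (v^2 * b^2)^2 - 24 * (v^4 * (b * e))"
    by algebra
  also have "\<dots> = a * (a^3 - 24 * d)"
    unfolding b2 b4 by algebra
  finally show "v^4 * (b * (b^3 - 24 * e)) = a * (a^3 - 24 * d)" .
  \<comment> \<open>The discriminant is 9 b2 b4 b6 - 8 b4^3 - 27 b6^2 - b2^2 b8. The last term
    vanishes on both curves, the law for b8 being the division polynomial relation.\<close>
  have "v^12 * (e^3 * (b^3 - 27 * e))
      = 9 * (v^2 * b^2) * (v^4 * (b * e)) * (v^6 * e^2) - 8 * (v^4 * (b * e))^3 - 27 * (v^6 * e^2)^2"
    by algebra
  also have "\<dots> = d^3 * (a^3 - 27 * d)"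
    unfolding b2 b4 b6 using b8 by algebra
  finally show "v^12 * (e^3 * (b^3 - 27 * e)) = d^3 * (a^3 - 27 * d)" .
qed

text \<open>A Hessian curve has c4 = u (u^3 + 216) and discriminant (u^3 - 27)^3. This is equality
  of the j-invariants c4^3 / discriminant, cleared of denominators.\<close>

lemma hessian_iso_invariant:
  fixes u w :: "'a::field"
  assumes "weier_iso (hessian_weier u) (hessian_weier w)"
  shows "u^3 * (u^3 + 216)^3 * (w^3 - 27)^3 = w^3 * (w^3 + 216)^3 * (u^3 - 27)^3"
proof -
  obtain v r s t where v: "v \<noteq> 0" and *: "v * (w + 6) = (u + 6) + 2 * s"
    "3 * r = s^2 + s * (u + 6)" "v^3 * (w^2 + 3 * w + 9) = (u^2 + 3 * u + 9) + r * (u + 6) + 2 * t"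
    "s * (u^2 + 3 * u + 9) + (t + r * s) * (u + 6) + 2 * s * t = 3 * r^2"
    "r^3 = t * (t + (u^2 + 3 * u + 9) + r * (u + 6))"
    using assms unfolding hessian_weier_def weier_iso_flex_form_iff by blast
  have c4: "(x + 6) * ((x + 6)^3 - 24 * (x^2 + 3 * x + 9)) = x * (x^3 + 216)" for x :: 'a
    by algebra
  have D: "(x^2 + 3 * x + 9)^3 * ((x + 6)^3 - 27 * (x^2 + 3 * x + 9)) = (x^3 - 27)^3" for x :: 'a
    by algebra
  have 1: "v^4 * (w * (w^3 + 216)) = u * (u^3 + 216)"
    using flex_form_invariants(1)[OF *] unfolding c4 .
  have 2: "v^12 * (w^3 - 27)^3 = (u^3 - 27)^3"
    using flex_form_invariants(2)[OF *] unfolding D .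
  have "(u * (u^3 + 216))^3 * (w^3 - 27)^3 = (w * (w^3 + 216))^3 * (u^3 - 27)^3"
    unfolding 1[symmetric] 2[symmetric] by (simp add: power_mult_distrib flip: power_mult)
  then show ?thesis by (simp add: power_mult_distrib)
qed

section \<open>Rigidity of Hessian curves when cubing is injective\<close>

text \<open>The form divides x^3 - y^3, so a zero has x = y and the form becomes 3 x^2.\<close>

lemma cube_inj_anisotropic:
  fixes x y :: "'a::field"
  assumes inj: "inj (\<lambda>x::'a. x^3)" and three: "(3::'a) \<noteq> 0" and 0: "x^2 + x * y + y^2 = 0"
  shows "x = 0" "y = 0"
proof -
  have "x^3 = y^3" using 0 by algebra
  then have "x = y" by (rule injD[OF inj])
  then have "3 * x^2 = 0" using 0 by (simp add: power2_eq_square)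
  then show "x = 0" using three by simp
  with \<open>x = y\<close> show "y = 0" by simp
qed

text \<open>
  The nontrivial factors of the \<open>3\<close>-division polynomial of a Hessian curve are norm forms of
  the cube roots of unity, so without such roots in the field the only affine flexes are
  \<open>(0, 0)\<close> and its negative.
\<close>
lemma hessian_flex_unique:
  fixes u r s t :: "'a::field"
  assumes inj: "inj (\<lambda>x::'a. x^3)" and u: "u^3 \<noteq> 27"
    and 1: "3 * r = s^2 + s * (u + 6)"
    and 2: "s * (u^2 + 3 * u + 9) + (t + r * s) * (u + 6) + 2 * s * t = 3 * r^2"
    and 3: "r^3 = t * (t + (u^2 + 3 * u + 9) + r * (u + 6))"
  shows "r = 0"
proof (cases "(3::'a) = 0")
  case True
  have "(6::'a) = 3 * 2" "(9::'a) = 3 * 3" "(27::'a) = 3 * 9" by simp_all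
  with True have char: "(6::'a) = 0" "(9::'a) = 0" "(27::'a) = 0" by (metis mult_zero_left)+
  with u have u0: "u \<noteq> 0" by auto
  \<comment> \<open>In characteristic 3 only two slopes remain, and each reduces the curve equation
    to r^3 = 0.\<close>
  have "s * (s + u) = 0" using 1 True char by (simp add: power2_eq_square distrib_left)
  then consider "s = 0" | "s = - u" by (auto simp: add_eq_0_iff)
  then show ?thesis
  proof cases
    case 1
    have "t * u = 0" using 2 True char 1 by simp
    then have "r^3 = 0" using u0 3 by simp
    then show ?thesis by simp
  next
    case s: 2
    have "- u * u^2 + (t + r * (- u)) * u + 2 * (- u) * t = 0" using 2 True char s by simp
    then have "u * (u^2 + t + r * u) = 0" by algebra
    then have "u^2 + t + r * u = 0" using u0 by simp
    then have "r^3 = 0" using 3 True char by (simp add: algebra_simps)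
    then show ?thesis by simp
  qed
next
  case three: False
  note aniso = cube_inj_anisotropic[OF inj three]
  define D where "D = u^2 + 3 * u + 9"
  show ?thesis
  proof (rule ccontr)
    assume r: "r \<noteq> 0"
    have "3 * r^3 + (u + 6)^2 * r^2 + 3 * (u + 6) * D * r + 3 * D^2 = 0"
      using flex_division_polynomial[OF 1 2 3] r by (simp add: D_def)
    \<comment> \<open>Nine times the cubic factor of the division polynomial splits. The linear
      factor is a norm form in \<open>s + 3\<close> and \<open>u\<close>; the quadratic one is 9
      times a norm form in \<open>r + u + 6\<close> and \<open>u - 3\<close>.\<close>
    then have "(3 * r + D) * (9 * r^2 + 27 * (u + 3) * r + 27 * D) = 0"
      unfolding D_def by algebra
    then consider "3 * r + D = 0" | "9 * r^2 + 27 * (u + 3) * r + 27 * D = 0" by auto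
    then show False
    proof cases
      case D: 1
      have q: "(s + 3)^2 + (s + 3) * u + u^2 = 0"
        using 1 D unfolding D_def by algebra
      have u0: "u = 0" and s: "s + 3 = 0"
        using aniso[OF q] by auto
      have "3 * (r + 3) = 0" using 1 u0 s by algebra
      with three have r3: "r + 3 = 0" by (metis mult_eq_0_iff)
      \<comment> \<open>For u = 0 and r = -3 the curve equation in \<open>t\<close> is again a norm
        form.\<close>
      have "(t - 6)^2 + (t - 6) * 3 + 3^2 = 0"
        using 3 u0 r3 by algebra
      from aniso(2)[OF this] three show False by simp
    next
      case 2
      have "(r + u + 6)^2 + (r + u + 6) * (u - 3) + (u - 3)^2 = (r^2 + 3 * (u + 3) * r + 3 * D)"
        unfolding D_def by algebra
      moreover have "9 * (r^2 + 3 * (u + 3) * r + 3 * D) = 0"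
        using 2 by algebra
      moreover have "(9::'a) \<noteq> 0"
      proof -
        have "(9::'a) = 3 * 3" by simp
        then show ?thesis using three by (metis mult_eq_0_iff)
      qed
      ultimately have "(r + u + 6)^2 + (r + u + 6) * (u - 3) + (u - 3)^2 = 0"
        by (metis mult_eq_0_iff)
      from aniso(2)[OF this] have "u = 3" by simp
      then show False using u by simp
    qed
  qed
qed

text \<open>With \<open>r = 0\<close> the isomorphism is a scaling, possibly composed with negation.
  The scaling also respects (u + 6)^3 - 27 D = (u - 3)^3, so by injectivity of cubing it takes both
  u + 6 and u - 3 to their counterparts, which pins down \<open>v\<close>.\<close>

lemma hessian_iso_imp_eq:
  fixes u w :: "'a::field"
  assumes inj: "inj (\<lambda>x::'a. x^3)" and u: "u^3 \<noteq> 27" and w: "w^3 \<noteq> 27"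
    and iso: "weier_iso (hessian_weier u) (hessian_weier w)"
  shows "u = w"
proof -
  define D where "D = u^2 + 3 * u + 9"
  obtain v r s t where v: "v \<noteq> 0" and 1: "v * (w + 6) = (u + 6) + 2 * s"
    and 2: "3 * r = s^2 + s * (u + 6)"
    and 3: "v^3 * (w^2 + 3 * w + 9) = (u^2 + 3 * u + 9) + r * (u + 6) + 2 * t"
    and 4: "s * (u^2 + 3 * u + 9) + (t + r * s) * (u + 6) + 2 * s * t = 3 * r^2"
    and 5: "r^3 = t * (t + (u^2 + 3 * u + 9) + r * (u + 6))"
    using iso unfolding hessian_weier_def weier_iso_flex_form_iff by blast
  have r: "r = 0" by (rule hessian_flex_unique[OF inj u 2 4 5])
  have uD: "u^3 - 27 = (u - 3) * D" unfolding D_def by algebra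
  have D: "D \<noteq> 0" using u uD by auto
  have "t = 0 \<or> t = - D" using 5 r by (auto simp: D_def add_eq_0_iff2)
  moreover have "s = 0" if "t = 0"
    using 4 r D that by (simp add: D_def)
  moreover have "s = - (u + 6)" if "t = - D"
  proof -
    have "D * (s + u + 6) = 0" using 4 r that unfolding D_def by algebra
    then show ?thesis using D by (simp add: add.assoc eq_neg_iff_add_eq_0 del: minus_add_distrib)
  qed
  ultimately consider "t = 0" "s = 0" | "t = - D" "s = - (u + 6)" by blast
  then have "(v * (w + 6) = u + 6 \<and> v^3 * (w^2 + 3 * w + 9) = D) \<or>
      (v * (w + 6) = - (u + 6) \<and> v^3 * (w^2 + 3 * w + 9) = - D)"
  proof cases
    case 2
    then show ?thesis using 1 3 r by (simp flip: D_def)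
  qed (use 1 3 r D_def in simp)
  \<comment> \<open>Negating \<open>v\<close> absorbs the negation of the curve.\<close>
  then obtain v where v: "v * (w + 6) = u + 6" "v^3 * (w^2 + 3 * w + 9) = D"
  proof
    assume *: "v * (w + 6) = - (u + 6) \<and> v^3 * (w^2 + 3 * w + 9) = - D"
    show ?thesis by (rule that[of "- v"]) (use * in algebra)+
  qed (use that in blast)
  have v0: "v \<noteq> 0" using v(2) D by auto
  have e: "(v * (w - 3))^3 = (u - 3)^3"
    using v unfolding D_def by algebra
  \<comment> \<open>The difference of the two linear relations gives 9 v = 9. It is vacuous in
    characteristic 3, where \<open>v = 1\<close> comes from comparing v w = u with v^3 w^2 =
    u^2.\<close>
  then have "v * (w - 3) = u - 3" by (rule injD[OF inj])
  then have 9: "9 * (v - 1) = 0" using v(1) by algebra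
  show ?thesis
  proof (cases "(3::'a) = 0")
    case True
    have "(6::'a) = 3 * 2" "(9::'a) = 3 * 3" "(27::'a) = 3 * 9" by simp_all
    with True have char: "(6::'a) = 0" "(9::'a) = 0" "(27::'a) = 0" by (metis mult_zero_left)+
    have "v * w = u" "v^3 * w^2 = u^2"
      using v True char by (simp_all add: D_def)
    moreover have "v^2 * w^2 * (v - 1) = v^3 * w^2 - (v * w)^2" by algebra
    ultimately have "v^2 * w^2 * (v - 1) = 0" by simp
    moreover have "w \<noteq> 0" using w char by auto
    ultimately have "v = 1" using v0 by auto
    then show ?thesis using v(1) by simp
  next
    case False
    have "(9::'a) = 3 * 3" by simp
    with False 9 have "v = 1" by (metis mult_eq_0_iff right_minus_eq)
    then show ?thesis using v(1) by simp
  qed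
qed

section \<open>The count when cubing is injective\<close>

lemma finite_field_power_card_minus_1:
  fixes x :: "'a::{finite, field}"
  assumes "x \<noteq> 0"
  shows "x ^ (CARD('a) - 1) = 1"
proof -
  let ?S = "UNIV - {0::'a}"
  have "bij_betw ((*) x) ?S ?S"
    using assms by (intro bij_betw_byWitness[where f' = "\<lambda>y. y / x"]) auto
  then have "(\<Prod>y\<in>?S. x * y) = \<Prod>?S"
    by (rule prod.reindex_bij_betw)
  moreover have "(\<Prod>y\<in>?S. x * y) = x ^ card ?S * \<Prod>?S"
    by (simp add: prod.distrib)
  moreover have "\<Prod>?S \<noteq> 0" by simp
  ultimately show ?thesis by (simp add: card_Diff_singleton)
qed

text \<open>If q = 3 k + 1, then (x^k)^3 = 1 for every unit, so injectivity gives x^k = 1: too many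
  roots for degree k.\<close>

lemma card_mod_3_if_cube_inj:
  assumes inj: "inj (\<lambda>x::'a::{finite, field}. x^3)"
  shows "CARD('a) mod 3 \<noteq> 1"
proof
  assume "CARD('a) mod 3 = 1"
  then obtain k where k: "CARD('a) = 3 * k + 1"
    by (metis div_mult_mod_eq mult.commute)
  \<comment> \<open>This ensures \<open>k > 0\<close>, without which the polynomial would be
    zero.\<close>
  have "card {0, 1 :: 'a} \<le> CARD('a)" by (rule card_mono) auto
  with k have k0: "k > 0" by simp
  let ?p = "monom 1 k - 1 :: 'a poly"
  have "coeff ?p k = 1" using k0 by (simp add: coeff_eq_0)
  then have p0: "?p \<noteq> 0" by (metis coeff_0 zero_neq_one)
  have "x ^ k = 1" if "x \<noteq> 0" for x :: 'a
  proof -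
    have "(x ^ k) ^ 3 = 1 ^ 3"
      using finite_field_power_card_minus_1[OF that] k
      by (simp add: mult.commute flip: power_mult)
    then show ?thesis by (rule injD[OF inj])
  qed
  then have "UNIV - {0} \<subseteq> {x. poly ?p x = 0}"
    by (auto simp: poly_monom)
  then have "card (UNIV - {0::'a}) \<le> card {x. poly ?p x = 0}"
    by (intro card_mono) auto
  also have "\<dots> \<le> degree ?p" by (rule card_poly_roots_bound[OF p0])
  also have "\<dots> \<le> k" by (intro degree_diff_le) (auto simp: degree_monom_le)
  finally show False using k k0 by (simp add: card_Diff_singleton)
qed

lemma I_H_if_cube_inj:
  assumes inj: "inj (\<lambda>x::'a::{finite, field}. x^3)"
  shows "I_H TYPE('a) = CARD('a) - 1"
proof -
  have rel: "(hessian_iso_rel :: 'a rel) = Id_on hessian_params"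
    unfolding hessian_iso_rel_def hessian_params_def
    using hessian_iso_imp_eq[OF inj] by (auto simp: Id_on_iff intro: weier_iso_refl)
  have "u^3 = 27 \<longleftrightarrow> u = 3" for u :: 'a
  proof
    assume "u^3 = 27"
    then have "u^3 = 3^3" by simp
    then show "u = 3" by (rule injD[OF inj])
  qed simp
  then have params: "(hessian_params :: 'a set) = UNIV - {3}"
    by (auto simp: hessian_params_def)
  have "card (hessian_params :: 'a set) = CARD('a) - 1"
    unfolding params by (rule card_Diff_singleton) simp
  moreover have "hessian_params // (hessian_iso_rel :: 'a rel) = (\<lambda>u. {u}) ` hessian_params"
    unfolding rel by (auto simp: quotient_def)
  ultimately show ?thesis
    by (simp add: I_H_def card_image)
qed

section \<open>The j-invariant and a Moebius map on parameters\<close>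

text \<open>The j-invariant c4^3 / discriminant. Division by zero gives 0 at the singular
  parameters, so fibers must require \<open>w^3 \<noteq> 27\<close> explicitly.\<close>

definition hessian_j :: "'a::field \<Rightarrow> 'a" where
  "hessian_j u = u^3 * (u^3 + 216)^3 / (u^3 - 27)^3"

lemma hessian_iso_imp_j_eq:
  assumes "u^3 \<noteq> 27" "w^3 \<noteq> 27" and "weier_iso (hessian_weier u) (hessian_weier w)"
  shows "hessian_j u = hessian_j w"
  using hessian_iso_invariant[OF assms(3)] assms(1,2) by (simp add: hessian_j_def frac_eq_eq)

text \<open>Outside characteristic 3 this is an involution. It permutes the parameters of the
  singular cubics of the Hesse pencil, exchanging 3 with infinity and 3 \<omega> with 3
  \<omega>^2.\<close>

definition hessian_mobius :: "'a::field \<Rightarrow> 'a" where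
  "hessian_mobius u = 3 * (u + 6) / (u - 3)"

lemma field_numerals_eq_0_iff:
  "(9::'a::field) = 0 \<longleftrightarrow> (3::'a) = 0"
  "(27::'a) = 0 \<longleftrightarrow> (3::'a) = 0"
  "(243::'a) = 0 \<longleftrightarrow> (3::'a) = 0"
  "(729::'a) = 0 \<longleftrightarrow> (3::'a) = 0"
  "(6::'a) = 0 \<longleftrightarrow> (2::'a) = 0 \<or> (3::'a) = 0"
  "(18::'a) = 0 \<longleftrightarrow> (2::'a) = 0 \<or> (3::'a) = 0"
  "(1728::'a) = 0 \<longleftrightarrow> (2::'a) = 0 \<or> (3::'a) = 0"
  "(78732::'a) = 0 \<longleftrightarrow> (2::'a) = 0 \<or> (3::'a) = 0"
proof -
  have "(9::'a) = 3^2" "(27::'a) = 3^3" "(243::'a) = 3^5" "(729::'a) = 3^6" "(6::'a) = 2 * 3"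
    "(18::'a) = 2 * 3^2" "(1728::'a) = 2^6 * 3^3" "(78732::'a) = 2^2 * 3^9"
    by simp_all
  then show "(9::'a::field) = 0 \<longleftrightarrow> (3::'a) = 0"
    "(27::'a) = 0 \<longleftrightarrow> (3::'a) = 0"
    "(243::'a) = 0 \<longleftrightarrow> (3::'a) = 0"
    "(729::'a) = 0 \<longleftrightarrow> (3::'a) = 0"
    "(6::'a) = 0 \<longleftrightarrow> (2::'a) = 0 \<or> (3::'a) = 0"
    "(18::'a) = 0 \<longleftrightarrow> (2::'a) = 0 \<or> (3::'a) = 0"
    "(1728::'a) = 0 \<longleftrightarrow> (2::'a) = 0 \<or> (3::'a) = 0"
    "(78732::'a) = 0 \<longleftrightarrow> (2::'a) = 0 \<or> (3::'a) = 0"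
    by (simp_all only: mult_eq_0_iff power_eq_0_iff zero_less_numeral simp_thms)
qed

section \<open>Isomorphisms in the presence of a primitive cube root of unity\<close>

context
  fixes \<omega> :: "'a::field"
  assumes omega: "\<omega>^2 + \<omega> + 1 = 0" and three: "(3::'a) \<noteq> 0"
begin

lemma omega_cube: "\<omega>^3 = 1"
  using omega by algebra

lemma omega_neq: "\<omega> \<noteq> 0" "\<omega> \<noteq> 1" "\<omega>^2 \<noteq> 1"
proof -
  show "\<omega> \<noteq> 0" using omega by auto
  show "\<omega> \<noteq> 1" using omega three by auto
  show "\<omega>^2 \<noteq> 1"
  proof
    assume "\<omega>^2 = 1"
    with omega_cube have "\<omega> = 1" by algebra
    with \<open>\<omega> \<noteq> 1\<close> show False ..
  qed
qed

lemma cube_eq_iff: "w^3 = y^3 \<longleftrightarrow> w = y \<or> w = \<omega> * y \<or> w = \<omega>^2 * y"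
proof -
  have "w^3 - y^3 = (w - y) * (w - \<omega> * y) * (w - \<omega>^2 * y)"
    using omega by algebra
  then show ?thesis
    by (metis (no_types, lifting) mult_eq_0_iff right_minus_eq)
qed

lemma card_cubes_eq:
  fixes y :: 'a
  assumes "y \<noteq> 0"
  shows "card {w. w^3 = y^3} = 3"
proof -
  have "{w. w^3 = y^3} = {y, \<omega> * y, \<omega>^2 * y}"
    by (auto simp: cube_eq_iff)
  then show ?thesis
    using assms omega_neq by (simp add: power2_eq_square)
qed

text \<open>Multiplying the coordinate Z by a suitable cube root of unity multiplies
  \<open>u\<close> by \<omega>. The base point (1:-1:0) stays fixed, but another flex moves to the
  Weierstrass origin.\<close>

lemma hessian_iso_omega: "weier_iso (hessian_weier u) (hessian_weier (\<omega> * u))"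
proof -
  \<comment> \<open>For nonsingular curves \<open>(r, t)\<close> is the image of the flex
    (0:1:-\<omega>) and \<open>s\<close> the slope of its tangent.\<close>
  define v r s t where "v = \<omega>^2" and "r = (\<omega>^2 - 1) * (u - 3 * \<omega>)" and "s = 3 * \<omega>^2 - 3"
    and "t = - 3 * r"
  have "v \<noteq> 0" using omega by (auto simp: v_def)
  moreover have "v * (\<omega> * u + 6) = (u + 6) + 2 * s"
    unfolding v_def s_def using omega by algebra
  moreover have "3 * r = s^2 + s * (u + 6)"
    unfolding r_def s_def using omega by algebra
  moreover have "v^3 * ((\<omega> * u)^2 + 3 * (\<omega> * u) + 9) = (u^2 + 3 * u + 9) + r * (u + 6) + 2 * t"
    unfolding v_def t_def r_def using omega by algebra
  moreover have "s * (u^2 + 3 * u + 9) + (t + r * s) * (u + 6) + 2 * s * t = 3 * r^2"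
    unfolding s_def t_def r_def using omega by algebra
  moreover have "r^3 = t * (t + (u^2 + 3 * u + 9) + r * (u + 6))"
    unfolding t_def r_def using omega by algebra
  ultimately show ?thesis
    unfolding hessian_weier_def weier_iso_flex_form_iff by blast
qed

text \<open>Here the flex moved to the origin is (1:-\<omega>^2:0), whose abscissa -D/3 is the root
  of the linear factor of the division polynomial.\<close>

lemma hessian_iso_mobius:
  fixes u :: 'a
  assumes u: "u \<noteq> 3"
  shows "weier_iso (hessian_weier u) (hessian_weier (hessian_mobius u))"
proof -
  define m where "m = hessian_mobius u"
  have m: "m * (u - 3) = 3 * (u + 6)"
    unfolding m_def hessian_mobius_def using u by simp
  \<comment> \<open>\<open>v\<close> solves v (m + 6) = u + 6 + 2 s, whose sides are 9 u v / (u - 3)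
    and (1 + 2 \<omega>) u; \<open>1 + 2 * \<omega>\<close> is a square root of -3. The conditions
    are checked after multiplying by 9 or 729 to clear denominators.\<close>
  define D v r s t where "D = u^2 + 3 * u + 9" and "v = (1 + 2 * \<omega>) * (u - 3) / 9"
    and "r = - D / 3" and "s = \<omega> * u - 3" and "t = D * ((1 - \<omega>) * u + 3 - 3 * \<omega>^2) / 9"
  have nz: "(9::'a) \<noteq> 0" "(729::'a) \<noteq> 0"
    using three by (simp_all add: field_numerals_eq_0_iff)
  have v: "9 * v = (1 + 2 * \<omega>) * (u - 3)" and r: "3 * r = - D"
    and t: "9 * t = D * ((1 - \<omega>) * u + 3 - 3 * \<omega>^2)"
    using nz three by (simp_all add: v_def r_def t_def)
  have "(1 + 2 * \<omega>)^2 = - 3" using omega by algebra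
  then have "v \<noteq> 0" using u nz three by (auto simp: v_def)
  moreover have "v * (m + 6) = (u + 6) + 2 * s"
  proof -
    have "9 * (v * (m + 6)) = 9 * ((u + 6) + 2 * s)"
      unfolding s_def using omega m v by algebra
    with nz(1) show ?thesis by (metis mult_left_cancel)
  qed
  moreover have "3 * r = s^2 + s * (u + 6)"
    unfolding r s_def D_def using omega by algebra
  moreover have "v^3 * (m^2 + 3 * m + 9) = D + r * (u + 6) + 2 * t"
  proof -
    have "729 * (v^3 * (m^2 + 3 * m + 9)) = (9 * v)^3 * (m^2 + 3 * m + 9)"
      by algebra
    also have "\<dots> = (1 + 2 * \<omega>)^3 * (u - 3) * ((m * (u - 3))^2 + 3 * (m * (u - 3)) * (u - 3) + 9 * (u - 3)^2)"
      unfolding v by algebra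
    also have "\<dots> = 81 * (9 * D + 3 * (3 * r) * (u + 6) + 2 * (9 * t))"
      unfolding r t m D_def using omega by algebra
    also have "\<dots> = 729 * (D + r * (u + 6) + 2 * t)" by algebra
    finally show ?thesis using nz(2) by (metis mult_left_cancel)
  qed
  moreover have "s * D + (t + r * s) * (u + 6) + 2 * s * t = 3 * r^2"
  proof -
    have "9 * (s * D + (t + r * s) * (u + 6) + 2 * s * t)
        = 9 * s * D + (9 * t + 3 * (3 * r) * s) * (u + 6) + 2 * s * (9 * t)"
      by algebra
    also have "\<dots> = 3 * (3 * r)^2"
      unfolding r t s_def D_def using omega by algebra
    also have "\<dots> = 9 * (3 * r^2)" by algebra
    finally show ?thesis using nz(1) by (metis mult_left_cancel)
  qed
  moreover have "r^3 = t * (t + D + r * (u + 6))"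
  proof -
    have "729 * r^3 = 27 * (3 * r)^3" by algebra
    also have "\<dots> = 9 * (9 * t) * (9 * t + 9 * D + 3 * (3 * r) * (u + 6))"
      unfolding r t D_def using omega by algebra
    also have "\<dots> = 729 * (t * (t + D + r * (u + 6)))" by algebra
    finally show ?thesis using nz(2) by (metis mult_left_cancel)
  qed
  ultimately show ?thesis
    unfolding m_def[symmetric] hessian_weier_def weier_iso_flex_form_iff D_def by blast
qed

lemma hessian_mobius_cube_ne_27:
  fixes x :: 'a
  assumes x: "x^3 \<noteq> 27"
  shows "hessian_mobius x ^ 3 \<noteq> 27"
proof
  assume *: "hessian_mobius x ^ 3 = 27"
  have "x \<noteq> 3" using x by auto
  then have m: "hessian_mobius x * (x - 3) = 3 * (x + 6)"
    by (simp add: hessian_mobius_def)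
  have "27 * (x - 3)^3 = (hessian_mobius x * (x - 3))^3"
    by (simp add: power_mult_distrib *)
  also have "\<dots> = 27 * (x + 6)^3"
    unfolding m by algebra
  finally have "729 * (x^3 - 27) = 0"
    by algebra
  moreover have "(729::'a) \<noteq> 0"
    using three by (simp add: field_numerals_eq_0_iff)
  ultimately show False using x by (metis mult_eq_0_iff right_minus_eq)
qed

lemma hessian_j_mobius:
  fixes x :: 'a
  assumes x: "x^3 \<noteq> 27"
  shows "hessian_j (hessian_mobius x) = hessian_j x"
proof -
  have "x \<noteq> 3" using x by auto
  from hessian_iso_imp_j_eq[OF x hessian_mobius_cube_ne_27[OF x] hessian_iso_mobius[OF this]]
  show ?thesis by simp
qed

text \<open>Since j depends only on the cube of the parameter, equality is a quartic equation in W =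
  w^3. Its roots are u^3 and the cubes of the Moebius images of the three cube roots of u^3.\<close>

lemma hessian_j_eq_iff:
  fixes u w :: 'a
  assumes u: "u^3 \<noteq> 27" and w: "w^3 \<noteq> 27"
  shows "hessian_j u = hessian_j w \<longleftrightarrow>
    w^3 = u^3 \<or> (\<exists>x\<in>{u, \<omega> * u, \<omega>^2 * u}. w^3 = hessian_mobius x ^ 3)"
proof
  assume "hessian_j u = hessian_j w"
  then have J: "u^3 * (u^3 + 216)^3 * (w^3 - 27)^3 = w^3 * (w^3 + 216)^3 * (u^3 - 27)^3"
    using u w by (simp add: hessian_j_def frac_eq_eq)
  define W where "W = w^3"
  \<comment> \<open>The cubic \<open>factor\<close> at x = u, with terms grouped by exponent modulo
    3. Replacing u by \<omega> u multiplies \<open>b\<close> by \<omega> and \<open>c\<close> by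
    \<omega>^2, so the three factors of a^3 + b^3 + c^3 - 3 a b c are its values at u, \<omega> u
    and \<omega>^2 u.\<close>
  define a b c where "a = (W - 27) * u^3 - 27 * (W + 216)" and "b = 27 * (W - 108) * u"
    and "c = - 9 * (W + 54) * u^2"
  have factor: "W * (x - 3)^3 - 27 * (x + 6)^3
      = (W - 27) * x^3 - 9 * (W + 54) * x^2 + 27 * (W - 108) * x - 27 * (W + 216)" for x
    by algebra
  have "(W - u^3) * ((a + b + c) * (a + \<omega> * b + \<omega>^2 * c) * (a + \<omega>^2 * b + \<omega> * c))
      = (W - u^3) * (a^3 + b^3 + c^3 - 3 * a * b * c)"
    using omega by algebra
  also have "\<dots> = W * (W + 216)^3 * (u^3 - 27)^3 - u^3 * (u^3 + 216)^3 * (W - 27)^3"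
    unfolding a_def b_def c_def by algebra
  also have "\<dots> = 0" using J by (simp add: W_def)
  finally consider "W = u^3" | "a + b + c = 0" | "a + \<omega> * b + \<omega>^2 * c = 0"
    | "a + \<omega>^2 * b + \<omega> * c = 0" by auto
  then have "W = u^3 \<or> (\<exists>x\<in>{u, \<omega> * u, \<omega>^2 * u}. W * (x - 3)^3 - 27 * (x + 6)^3 = 0)"
  proof cases
    case 2
    then have "W * (u - 3)^3 - 27 * (u + 6)^3 = 0"
      unfolding factor a_def b_def c_def by algebra
    then show ?thesis by blast
  next
    case 3
    then have "W * (\<omega> * u - 3)^3 - 27 * (\<omega> * u + 6)^3 = 0"
      unfolding factor a_def b_def c_def using omega_cube by algebra
    then show ?thesis by blast
  next
    case 4
    then have "W * (\<omega>^2 * u - 3)^3 - 27 * (\<omega>^2 * u + 6)^3 = 0"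
      unfolding factor a_def b_def c_def using omega_cube by algebra
    then show ?thesis by blast
  qed simp
  then show "w^3 = u^3 \<or> (\<exists>x\<in>{u, \<omega> * u, \<omega>^2 * u}. w^3 = hessian_mobius x ^ 3)"
  proof (elim disjE bexE)
    fix x assume x: "x \<in> {u, \<omega> * u, \<omega>^2 * u}" and 0: "W * (x - 3)^3 - 27 * (x + 6)^3 = 0"
    have "x^3 = u^3" using x cube_eq_iff[of x u] by auto
    with u have "x \<noteq> 3" by auto
    then have "hessian_mobius x * (x - 3) = 3 * (x + 6)"
      by (simp add: hessian_mobius_def)
    with 0 have "(w^3 - hessian_mobius x ^ 3) * (x - 3)^3 = 0"
      unfolding W_def by algebra
    with \<open>x \<noteq> 3\<close> have "w^3 = hessian_mobius x ^ 3" by simp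
    with x show ?thesis by blast
  qed (simp add: W_def)
next
  have cube: "hessian_j x = hessian_j y" if "x^3 = y^3" for x y :: 'a
    using that by (simp add: hessian_j_def)
  assume "w^3 = u^3 \<or> (\<exists>x\<in>{u, \<omega> * u, \<omega>^2 * u}. w^3 = hessian_mobius x ^ 3)"
  then show "hessian_j u = hessian_j w"
  proof (elim disjE bexE)
    fix x assume x: "x \<in> {u, \<omega> * u, \<omega>^2 * u}" and wx: "w^3 = hessian_mobius x ^ 3"
    have xu: "x^3 = u^3" using x cube_eq_iff[of x u] by auto
    with u have "x^3 \<noteq> 27" by simp
    then show ?thesis
      using cube[OF xu] cube[OF wx] hessian_j_mobius by metis
  qed (metis cube)
qed

text \<open>Each solution \<open>w\<close> of the j-equation is reached by composing multiplications
  by \<omega> with at most one Moebius step.\<close>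

lemma hessian_iso_iff_j_eq:
  fixes u w :: 'a
  assumes u: "u^3 \<noteq> 27" and w: "w^3 \<noteq> 27"
  shows "weier_iso (hessian_weier u) (hessian_weier w) \<longleftrightarrow> hessian_j u = hessian_j w"
proof
  assume "hessian_j u = hessian_j w"
  moreover have cube: "weier_iso (hessian_weier x) (hessian_weier y)" if "y^3 = x^3" for x y :: 'a
    using that weier_iso_refl[of "hessian_weier x"] hessian_iso_omega[of x]
      weier_iso_trans[OF hessian_iso_omega[of x] hessian_iso_omega[of "\<omega> * x"]]
    by (auto simp: cube_eq_iff power2_eq_square mult.assoc simp del: split_paired_All)
  moreover have "weier_iso (hessian_weier u) (hessian_weier w)"
    if x: "x \<in> {u, \<omega> * u, \<omega>^2 * u}" and wx: "w^3 = hessian_mobius x ^ 3" for x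
  proof -
    have xu: "x^3 = u^3" using x cube_eq_iff[of x u] by auto
    with u have "x \<noteq> 3" by auto
    from weier_iso_trans[OF weier_iso_trans[OF cube[OF xu] hessian_iso_mobius[OF this]] cube[OF wx]]
    show ?thesis .
  qed
  ultimately show "weier_iso (hessian_weier u) (hessian_weier w)"
    using hessian_j_eq_iff[OF u w] by blast
qed (rule hessian_iso_imp_j_eq[OF u w])

section \<open>Sizes of the fibers of j\<close>

text \<open>Four values of w^3 occur, each with three cube roots. A zero or a coincidence among the
  four would force j = 0, j = 1728 or a singular curve.\<close>

lemma card_hessian_j_fiber:
  fixes u :: 'a
  assumes u: "u^3 \<noteq> 27" and j0: "hessian_j u \<noteq> 0" and j1728: "hessian_j u \<noteq> 1728"
  shows "card {w. w^3 \<noteq> 27 \<and> hessian_j w = hessian_j u} = 12"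
proof -
  define T where "T y = {w::'a. w^3 = y^3}" for y
  let ?f = hessian_mobius
  define x1 x2 where "x1 = \<omega> * u" and "x2 = \<omega>^2 * u"
  have cubes: "x1^3 = u^3" "x2^3 = u^3"
    using cube_eq_iff[of x1 u] cube_eq_iff[of x2 u] by (auto simp: x1_def x2_def)
  have nz: "(9::'a) \<noteq> 0" "(27::'a) \<noteq> 0"
    using three by (simp_all add: field_numerals_eq_0_iff)
  have u0: "u \<noteq> 0" and u216: "u^3 + 216 \<noteq> 0"
    using j0 by (auto simp: hessian_j_def)
  \<comment> \<open>The identity c4^3 - 1728 discriminant = c6^2.\<close>
  have "u^3 * (u^3 + 216)^3 - 1728 * (u^3 - 27)^3 = (u^6 - 540 * u^3 - 5832)^2"
    by algebra
  then have S: "u^6 - 540 * u^3 - 5832 \<noteq> 0"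
    using j1728 u by (auto simp: hessian_j_def divide_eq_eq)
  have Q: "x^2 - 6 * x - 18 \<noteq> 0" "x^2 - 6 * x + 36 \<noteq> 0" "x^2 + 3 * x + 9 \<noteq> 0" "x + 6 \<noteq> 0" "x \<noteq> 3"
    if x: "x^3 = u^3" for x
  proof -
    have "(x^2 - 6 * x - 18) * (x^4 + 6 * x^3 + 54 * x^2 - 108 * x + 324) = u^6 - 540 * u^3 - 5832"
      using x by algebra
    with S show "x^2 - 6 * x - 18 \<noteq> 0" by auto
    have "(x^2 - 6 * x + 36) * (x + 6) = u^3 + 216"
      using x by algebra
    with u216 show "x^2 - 6 * x + 36 \<noteq> 0" "x + 6 \<noteq> 0" by auto
    have "(x^2 + 3 * x + 9) * (x - 3) = u^3 - 27"
      using x by algebra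
    with u show "x^2 + 3 * x + 9 \<noteq> 0" "x \<noteq> 3" by auto
  qed
  have m: "?f x * (x - 3) = 3 * (x + 6)" if "x^3 = u^3" for x
    using Q(5)[OF that] by (simp add: hessian_mobius_def)
  have f0: "?f x \<noteq> 0" if "x^3 = u^3" for x
    using Q(4,5)[OF that] three by (simp add: hessian_mobius_def del: distrib_left_numeral)
  have uf: "?f x ^ 3 \<noteq> u^3" if x: "x^3 = u^3" for x
  proof
    assume "?f x ^ 3 = u^3"
    then have "(x * (x - 3))^3 = (3 * (x + 6))^3"
      using x unfolding m[OF x, symmetric] by (simp add: power_mult_distrib)
    then have "(x^2 - 6 * x - 18) * (x^2 - 6 * x + 36) * (x^2 + 3 * x + 9) = 0"
      by algebra
    then show False using Q(1-3)[OF x] by simp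
  qed
  have ff: "?f x ^ 3 \<noteq> ?f y ^ 3" if x: "x^3 = u^3" and y: "y^3 = u^3" and "x \<noteq> y" for x y
  proof
    assume eq: "?f x ^ 3 = ?f y ^ 3"
    \<comment> \<open>\<open>z\<close> is the third cube root of u^3, as the three roots sum to
      zero; it lets the norm form below be written in one variable, where \<open>Q\<close>
      applies.\<close>
    define z where "z = - x - y"
    have "(x - y) * (x^2 + x * y + y^2) = 0" using x y by algebra
    with \<open>x \<noteq> y\<close> have xy: "x^2 + x * y + y^2 = 0" by simp
    then have z: "z^3 = u^3" using x unfolding z_def by algebra
    have "27 * ((x + 6) * (y - 3))^3 = (?f x * (x - 3))^3 * (y - 3)^3"
      unfolding m[OF x] by algebra
    also have "\<dots> = (?f y * (y - 3))^3 * (x - 3)^3"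
      using eq by (simp add: power_mult_distrib)
    also have "\<dots> = 27 * ((y + 6) * (x - 3))^3"
      unfolding m[OF y] by algebra
    finally have "((x + 6) * (y - 3))^3 = ((y + 6) * (x - 3))^3"
      using nz(2) by simp
    define a b where "a = (x + 6) * (y - 3)" and "b = (y + 6) * (x - 3)"
    have "a - b = 9 * (y - x)"
      unfolding a_def b_def by algebra
    moreover have "a^2 + a * b + b^2 = 3 * ((z + 6) * (z - 3) * (z^2 - 6 * z - 18))"
      using xy unfolding a_def b_def z_def by algebra
    moreover have "(a - b) * (a^2 + a * b + b^2) = 0"
      using \<open>((x + 6) * (y - 3))^3 = ((y + 6) * (x - 3))^3\<close> unfolding a_def b_def by algebra
    ultimately have "9 * (y - x) * (3 * ((z + 6) * (z - 3) * (z^2 - 6 * z - 18))) = 0"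
      by simp
    then show False
      using nz(1) three \<open>x \<noteq> y\<close> Q[OF z] by simp
  qed
  have neq: "u \<noteq> x1" "u \<noteq> x2" "x1 \<noteq> x2"
    using u0 omega_neq by (auto simp: x1_def x2_def power2_eq_square)
  have disj: "T x \<inter> T y = {}" if "x^3 \<noteq> y^3" for x y
    using that by (auto simp: T_def)
  have card: "card (T y) = 3" "finite (T y)" if "y \<noteq> 0" for y
    using card_cubes_eq[OF that] card.infinite[of "T y"] by (auto simp: T_def)
  have w27: "w^3 \<noteq> 27" if "w^3 = u^3 \<or> (\<exists>x\<in>{u, x1, x2}. w^3 = ?f x ^ 3)" for w
    using that u cubes by (metis hessian_mobius_cube_ne_27 insertE empty_iff)
  have "w^3 \<noteq> 27 \<and> hessian_j w = hessian_j u \<longleftrightarrow> w^3 = u^3 \<or> (\<exists>x\<in>{u, x1, x2}. w^3 = ?f x ^ 3)" for w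
    using hessian_j_eq_iff[OF u, of w] w27[of w] unfolding x1_def x2_def by metis
  then have "{w. w^3 \<noteq> 27 \<and> hessian_j w = hessian_j u} = T u \<union> (T (?f u) \<union> (T (?f x1) \<union> T (?f x2)))"
    by (auto simp: T_def)
  also have "card \<dots> = 12"
  proof -
    have "T u \<inter> T (?f x) = {}" if "x^3 = u^3" for x
      using uf[OF that] by (intro disj) simp
    then have "T u \<inter> (T (?f u) \<union> (T (?f x1) \<union> T (?f x2))) = {}"
      using cubes by (simp add: Int_Un_distrib)
    moreover have "T (?f u) \<inter> (T (?f x1) \<union> T (?f x2)) = {}" "T (?f x1) \<inter> T (?f x2) = {}"
      using cubes neq by (simp_all add: Int_Un_distrib disj ff)
    moreover have "?f u \<noteq> 0" "?f x1 \<noteq> 0" "?f x2 \<noteq> 0"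
      using cubes by (simp_all add: f0)
    ultimately show ?thesis
      using u0 by (simp add: card card_Un_disjoint)
  qed
  finally show ?thesis .
qed

lemma card_hessian_j_fiber_0:
  "card {w::'a. w^3 \<noteq> 27 \<and> hessian_j w = 0} = (if (2::'a) = 0 then 1 else 4)"
proof -
  \<comment> \<open>27 + 216 = 243 = 3^5, so the cube roots of -216 are admissible. In
    characteristic 2 they coincide with 0.\<close>
  have "(243::'a) \<noteq> 0" using three by (simp add: field_numerals_eq_0_iff)
  then have "(- 216::'a) \<noteq> 27" by (simp add: neg_eq_iff_add_eq_0)
  moreover have "(27::'a) \<noteq> 0" using three by (simp add: field_numerals_eq_0_iff)
  moreover have "w^3 + 216 = 0 \<longleftrightarrow> w^3 = - 216" for w :: 'a
    by (rule add_eq_0_iff2)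
  ultimately have eq: "{w::'a. w^3 \<noteq> 27 \<and> hessian_j w = 0} = insert 0 {w. w^3 = (- 6)^3}"
    by (auto simp: hessian_j_def)
  show ?thesis
  proof (cases "(2::'a) = 0")
    case True
    then have "(6::'a) = 0" by (simp add: field_numerals_eq_0_iff)
    then have "{w::'a. w^3 = (- 6)^3} = {0}" by simp
    with True show ?thesis unfolding eq by simp
  next
    case False
    then have "(- 6::'a) \<noteq> 0" using three by (simp add: field_numerals_eq_0_iff)
    with card_cubes_eq[OF this] False show ?thesis
      unfolding eq using card.infinite[of "{w::'a. w^3 = (- 6)^3}"]
      by (subst card_insert_disjoint) auto
  qed
qed

text \<open>The condition is quadratic in w^3. One rational solution \<open>a\<close> makes both
  roots cubes, so this fiber is either empty or has six elements.\<close>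

lemma card_hessian_j_fiber_1728:
  fixes a :: 'a
  assumes two: "(2::'a) \<noteq> 0" and a: "a^3 \<noteq> 27" and ja: "hessian_j a = 1728"
  shows "card {w::'a. w^3 \<noteq> 27 \<and> hessian_j w = 1728} = 6"
proof -
  have nz: "(18::'a) \<noteq> 0" "(78732::'a) \<noteq> 0" "(729::'a) \<noteq> 0" "(27::'a) \<noteq> 0"
    using two three by (simp_all add: field_numerals_eq_0_iff)
  have j_iff: "hessian_j w = 1728 \<longleftrightarrow> w^6 - 540 * w^3 - 5832 = 0" if "w^3 \<noteq> 27" for w :: 'a
  proof -
    have "hessian_j w = 1728 \<longleftrightarrow> w^3 * (w^3 + 216)^3 - 1728 * (w^3 - 27)^3 = 0"
      using that by (simp add: hessian_j_def divide_eq_eq)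
    also have "w^3 * (w^3 + 216)^3 - 1728 * (w^3 - 27)^3 = (w^6 - 540 * w^3 - 5832)^2"
      by algebra
    finally show ?thesis by simp
  qed
  have Sa: "a^6 - 540 * a^3 - 5832 = 0" using j_iff[OF a] ja by simp
  have S27: "w^3 \<noteq> 27" if "w^6 - 540 * w^3 - 5832 = 0" for w :: 'a
  proof
    assume "w^3 = 27"
    moreover have "w^6 = (w^3)^2" by algebra
    ultimately have "(- 19683::'a) = 0" using that by simp
    moreover have "(19683::'a) = 729 * 27" by simp
    ultimately show False using nz by (metis mult_eq_0_iff neg_equal_0_iff_equal)
  qed
  have a0: "a \<noteq> 0"
  proof
    assume "a = 0"
    with Sa have "(5832::'a) = 0" by simp
    moreover have "(5832::'a) = 18 * (18 * 18)" by simp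
    ultimately show False using nz by (metis mult_eq_0_iff)
  qed
  \<comment> \<open>The quadratic in w^3 has root product -5832 = (-18)^3, so \<open>b^3\<close> is
    the other root.\<close>
  define b where "b = - 18 / a"
  have ab: "a * b = - 18" and b0: "b \<noteq> 0"
    using a0 nz by (simp_all add: b_def)
  have sum: "a^3 + b^3 = 540"
  proof -
    have "a^3 * (a^3 + b^3 - 540) = 0" using Sa ab by algebra
    then show ?thesis using a0 by simp
  qed
  have "w^6 - 540 * w^3 - 5832 = (w^3 - a^3) * (w^3 - b^3)" for w
  proof -
    have "(w^3 - a^3) * (w^3 - b^3) = w^6 - (a^3 + b^3) * w^3 + (a * b)^3" by algebra
    then show ?thesis unfolding sum ab by simp
  qed
  then have "{w::'a. w^3 \<noteq> 27 \<and> hessian_j w = 1728} = {w. w^3 = a^3} \<union> {w. w^3 = b^3}"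
    using j_iff S27 by auto
  moreover have "a^3 \<noteq> b^3"
  proof
    assume "a^3 = b^3"
    \<comment> \<open>A double root would annihilate the discriminant 540^2 + 4 * 5832 = 2^4 *
      3^9.\<close>
    then have "4 * (a^3 * b^3) = (a^3 + b^3)^2" by algebra
    also have "a^3 * b^3 = (a * b)^3" by algebra
    finally have "(- 23328::'a) = 291600" unfolding ab sum by simp
    then have "(291600 + 23328::'a) = 0" by (metis neg_eq_iff_add_eq_0 add.commute)
    moreover have "(291600 + 23328::'a) = 78732 * (2 * 2)" by simp
    ultimately show False using nz two by (metis mult_eq_0_iff)
  qed
  then have "{w. w^3 = a^3} \<inter> {w. w^3 = b^3} = {}" by auto
  moreover have "finite {w. w^3 = a^3}" "finite {w. w^3 = b^3}"
    using card_cubes_eq[OF a0] card_cubes_eq[OF b0] by (simp_all add: card_ge_0_finite)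
  ultimately show ?thesis
    using card_cubes_eq[OF a0] card_cubes_eq[OF b0] by (simp add: card_Un_disjoint)
qed

end

section \<open>Counting the values of j\<close>

lemma I_H_eq_card_j_image:
  fixes \<omega> :: "'a::{finite, field}"
  assumes omega: "\<omega>^2 + \<omega> + 1 = 0" and three: "(3::'a) \<noteq> 0"
  shows "I_H TYPE('a) = card (hessian_j ` (hessian_params :: 'a set))"
proof -
  let ?F = "\<lambda>c. {w \<in> hessian_params :: 'a set. hessian_j w = c}"
  have rel: "(hessian_iso_rel :: 'a rel) = {(u, w). u \<in> hessian_params \<and> w \<in> hessian_params \<and> hessian_j u = hessian_j w}"
    unfolding hessian_iso_rel_def using hessian_iso_iff_j_eq[OF omega three]
    by (auto simp: hessian_params_def)
  have "hessian_iso_rel `` {u} = ?F (hessian_j u)" if "u \<in> hessian_params" for u :: 'a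
    unfolding rel using that by auto
  then have "hessian_params // (hessian_iso_rel :: 'a rel) = ?F ` hessian_j ` hessian_params"
    by (auto simp: quotient_def)
  moreover have "inj_on ?F (hessian_j ` hessian_params)"
    by (rule inj_onI) blast
  ultimately show ?thesis
    by (simp add: I_H_def card_image)
qed

text \<open>Three parameters are singular, so q - 3 is the sum of the fiber sizes over the values of
  j; this fixes both q modulo 3 and the number of values.\<close>

lemma I_H_if_cube_root_of_unity:
  fixes \<omega> :: "'a::{finite, field}"
  assumes omega: "\<omega>^2 + \<omega> + 1 = 0" and three: "(3::'a) \<noteq> 0"
  shows "CARD('a) mod 3 = 1" and "I_H TYPE('a) = (CARD('a) + 11) div 12"
proof -
  let ?P = "hessian_params :: 'a set"
  define J where "J = hessian_j ` ?P"
  let ?F = "\<lambda>c. {w::'a. w^3 \<noteq> 27 \<and> hessian_j w = c}"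
  have fin: "finite J" by (simp add: J_def)
  have "(0::'a) \<in> ?P"
    using three field_numerals_eq_0_iff(2)[where ?'a = 'a] by (auto simp: hessian_params_def)
  moreover have "hessian_j (0::'a) = 0" by (simp add: hessian_j_def)
  ultimately have J0: "0 \<in> J" unfolding J_def by (metis imageI)
  have generic: "card (?F c) = 12" if "c \<in> J" "c \<noteq> 0" "c \<noteq> 1728" for c
    using that card_hessian_j_fiber[OF omega three] by (auto simp: J_def hessian_params_def)
  have "card {w::'a. w^3 = 3^3} = 3"
    using card_cubes_eq[OF omega three three] .
  moreover have params: "?P = UNIV - {w. w^3 = 3^3}"
    by (auto simp: hessian_params_def)
  ultimately have "card ?P = CARD('a) - 3"
    unfolding params by (subst card_Diff_subset) auto
  moreover have "card {w::'a. w^3 = 3^3} \<le> CARD('a)"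
    by (rule card_mono) auto
  moreover have "card ?P = (\<Sum>c\<in>J. card (?F c))"
    using sum.image_gen[of ?P "\<lambda>_. 1::nat" hessian_j] by (simp add: J_def hessian_params_def)
  ultimately have q: "CARD('a) = 3 + (\<Sum>c\<in>J. card (?F c))"
    using \<open>card {w::'a. w^3 = 3^3} = 3\<close> by simp
  have card0: "card (?F 0) = (if (2::'a) = 0 then 1 else 4)"
    by (rule card_hessian_j_fiber_0[OF omega three])
  define n where "n = card (J - {0, 1728})"
  have rest: "(\<Sum>c\<in>J - {0, 1728}. card (?F c)) = 12 * n"
    using generic by (simp add: n_def)
  have split0: "(\<Sum>c\<in>J. card (?F c)) = card (?F 0) + (\<Sum>c\<in>J - {0}. card (?F c))" "card J = 1 + card (J - {0})"
    using sum.remove[OF fin J0] card.remove[OF fin J0] by simp_all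
  consider "(2::'a) = 0 \<or> 1728 \<notin> J" | "(2::'a) \<noteq> 0" "1728 \<in> J" by blast
  then have "(CARD('a) mod 3 = 1) \<and> card J = (CARD('a) + 11) div 12"
  proof cases
    case 1
    \<comment> \<open>In characteristic 2 the values 0 and 1728 coincide.\<close>
    then have "J - {0} = J - {0, 1728}" by (auto simp: field_numerals_eq_0_iff)
    then have "CARD('a) = 3 + (if (2::'a) = 0 then 1 else 4) + 12 * n" "card J = 1 + n"
      using q split0 rest card0 by (simp_all add: n_def)
    \<comment> \<open>q is 4 + 12 n in characteristic 2 and 7 + 12 n otherwise, with n + 1 values of
      j.\<close>
    then show ?thesis by (cases "(2::'a) = 0"; simp; presburger)
  next
    case 2
    then obtain a :: 'a where "a^3 \<noteq> 27" "hessian_j a = 1728"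
      by (auto simp: J_def hessian_params_def)
    from card_hessian_j_fiber_1728[OF omega three 2(1) this]
    have card1728: "card (?F 1728) = 6" .
    have J1728: "1728 \<in> J - {0}"
      using 2 three by (simp add: field_numerals_eq_0_iff)
    have *: "J - {0} - {1728} = J - {0, 1728}" by auto
    have "(\<Sum>c\<in>J - {0}. card (?F c)) = 6 + 12 * n" "card (J - {0}) = 1 + n"
      using sum.remove[OF _ J1728, of "\<lambda>c. card (?F c)"] card.remove[OF _ J1728] fin rest card1728
      unfolding * by (simp_all add: n_def)
    then have "CARD('a) = 13 + 12 * n" "card J = 2 + n"
      using q split0 card0 2(1) by simp_all
    then show ?thesis by presburger
  qed
  then show "CARD('a) mod 3 = 1" and "I_H TYPE('a) = (CARD('a) + 11) div 12"
    using I_H_eq_card_j_image[OF omega three] by (simp_all add: J_def)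
qed

theorem mainTheorem13:
  "I_H TYPE('a::{finite, field}) =
     (if CARD('a) mod 3 = 1 then (CARD('a) + 11) div 12 else CARD('a) - 1)"
proof (cases "inj (\<lambda>x::'a. x^3)")
  case True
  then show ?thesis
    using I_H_if_cube_inj card_mod_3_if_cube_inj by auto
next
  case False
  then obtain x y :: 'a where xy: "x^3 = y^3" "x \<noteq> y"
    by (auto simp: inj_def)
  \<comment> \<open>In characteristic 3 cubing is additive, hence injective.\<close>
  have "(x - y)^3 = x^3 - y^3 - 3 * (x * y * (x - y))" by algebra
  with xy have three: "(3::'a) \<noteq> 0" by auto
  have "y \<noteq> 0" using xy by auto
  have "(x - y) * (x^2 + x * y + y^2) = 0" using xy(1) by algebra
  with xy(2) have "x^2 + x * y + y^2 = 0" by simp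
  \<comment> \<open>The quotient of two distinct elements with equal cubes is a primitive cube root
    of unity.\<close>
  then have "(x / y)^2 + x / y + 1 = 0"
    using \<open>y \<noteq> 0\<close> by (simp add: field_simps power2_eq_square)
  then show ?thesis
    using I_H_if_cube_root_of_unity[OF _ three] by simp
qed

end
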